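(* Let $(X,d)$ be a Hadamard space and let $h:X\to\mathbb{R}$ be a lower semicontinuous function that is strongly quasiconvex (with some modulus $\gamma>0$). Then $\operatorname{argmin}_{x\in X}h(x)$ is nonempty.
   Context: A Hadamard space is a (nonempty) complete CAT(0) space (complete geodesic metric space of nonpositive curvature). Such a space is uniquely geodesic, and $(1-\lambda)x\oplus\lambda y$ denotes the point at distance $\lambda d(x,y)$ from $x$ on the unique geodesic joining $x$ to $y$. A function $h:X\to\mathbb{R}$ is strongly quasiconvex with modulus $\gamma>0$ if $h((1-\lambda)x\oplus\lambda y)\le\max\{h(x),h(y)\}-\lambda(1-\lambda)\frac{\gamma}{2}d^2(x,y)$ for all $x,y\in X$, $\lambda\in[0,1]$. *)

theory Defs
  imports "HOL-Analysis.Analysis"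
begin

definition lower_semicontinuous_map :: "'a topology \<Rightarrow> ('a \<Rightarrow> real) \<Rightarrow> bool" where
  "lower_semicontinuous_map T f \<longleftrightarrow>
    (\<forall>x\<in>topspace T. \<forall>a<f x. \<forall>\<^sub>F y in atin T x. a < f y)"

context Metric_space
begin

definition geodesic :: "(real \<Rightarrow> 'a) \<Rightarrow> 'a \<Rightarrow> 'a \<Rightarrow> bool" where
  "geodesic c x y \<longleftrightarrow>
    c \<in> {0..d x y} \<rightarrow> M \<and> c 0 = x \<and> c (d x y) = y \<and>
    (\<forall>s\<in>{0..d x y}. \<forall>t\<in>{0..d x y}. d (c s) (c t) = \<bar>s - t\<bar>)"

definition geodesic_segment :: "'a set \<Rightarrow> 'a \<Rightarrow> 'a \<Rightarrow> bool" where
  "geodesic_segment S x y \<longleftrightarrow> (\<exists>c. geodesic c x y \<and> S = c ` {0..d x y})"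

definition geodesic_space :: bool where
  "geodesic_space \<longleftrightarrow> (\<forall>x\<in>M. \<forall>y\<in>M. \<exists>c. geodesic c x y)"

text \<open>
  The pairs of a point \<open>x\<close> on a geodesic segment \<open>S\<close> from \<open>p\<close> to \<open>q\<close> and its comparison
  point \<open>x'\<close> on the Euclidean segment from \<open>p'\<close> to \<open>q'\<close>.
\<close>

definition comparison_points ::
    "'a set \<Rightarrow> 'a \<Rightarrow> real^2 \<Rightarrow> real^2 \<Rightarrow> ('a \<times> (real^2)) set" where
  "comparison_points S p p' q' =
    {(x, x'). x \<in> S \<and> x' \<in> closed_segment p' q' \<and> dist p' x' = d p x}"

text \<open>
  The comparison-triangle definition: distances between any two points of a geodesic triangle
  are at most the distances between their comparison points in the Euclidean plane.
\<close>

definition CAT0 :: bool where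
  "CAT0 \<longleftrightarrow> geodesic_space \<and>
    (\<forall>p\<in>M. \<forall>q\<in>M. \<forall>r\<in>M. \<forall>S1 S2 S3. \<forall>p' q' r' :: real^2.
      geodesic_segment S1 p q \<and> geodesic_segment S2 q r \<and> geodesic_segment S3 r p \<and>
      dist p' q' = d p q \<and> dist q' r' = d q r \<and> dist r' p' = d r p \<longrightarrow>
      (let C = comparison_points S1 p p' q' \<union> comparison_points S2 q q' r' \<union>
               comparison_points S3 r r' p'
       in \<forall>(x, x')\<in>C. \<forall>(y, y')\<in>C. d x y \<le> dist x' y'))"

text \<open>
  The point \<open>(1 - t) x \<oplus> t y\<close>. It is meaningful where geodesics are unique, in particular in
  a CAT(0) space; see \<open>geodesic_comb_eq\<close> below.
\<close>

definition geodesic_comb :: "real \<Rightarrow> 'a \<Rightarrow> 'a \<Rightarrow> 'a" where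
  "geodesic_comb t x y = (THE z. \<exists>c. geodesic c x y \<and> z = c (t * d x y))"

definition strongly_quasiconvex :: "real \<Rightarrow> ('a \<Rightarrow> real) \<Rightarrow> bool" where
  "strongly_quasiconvex \<gamma> h \<longleftrightarrow> \<gamma> > 0 \<and>
    (\<forall>x\<in>M. \<forall>y\<in>M. \<forall>t\<in>{0..1}.
      h (geodesic_comb t x y) \<le> max (h x) (h y) - t * (1 - t) * (\<gamma> / 2) * (d x y)\<^sup>2)"

lemma CAT0_geodesic_unique:
  assumes "CAT0" "x \<in> M" "y \<in> M" "geodesic c x y" "geodesic e x y" "t \<in> {0..d x y}"
  shows "c t = e t"
proof -
  define D where "D = d x y"
  have D: "0 \<le> D" "d y x = D" "d x x = 0" "d y y = 0"
    using assms(2,3) by (auto simp: D_def commute)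
  have t: "0 \<le> t" "t \<le> D" using assms(6) by (auto simp: D_def)
  have c: "c \<in> {0..D} \<rightarrow> M" "c 0 = x" "c D = y"
      "\<And>s u. s \<in> {0..D} \<Longrightarrow> u \<in> {0..D} \<Longrightarrow> d (c s) (c u) = \<bar>s - u\<bar>"
    using assms(4) by (auto simp: geodesic_def D_def)
  have e: "e \<in> {0..D} \<rightarrow> M" "e 0 = x" "e D = y"
      "\<And>s u. s \<in> {0..D} \<Longrightarrow> u \<in> {0..D} \<Longrightarrow> d (e s) (e u) = \<bar>s - u\<bar>"
    using assms(5) by (auto simp: geodesic_def D_def)
  have S1: "geodesic_segment (c ` {0..D}) x y"
    using assms(4) by (auto simp: geodesic_segment_def D_def)
  have S2: "geodesic_segment {y} y y"
    unfolding geodesic_segment_def geodesic_def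
    using D assms(3) by (intro exI[of _ "\<lambda>_. y"]) auto
  have S3: "geodesic_segment (e ` {0..D}) y x"
  proof -
    have "geodesic (\<lambda>s. e (D - s)) y x"
      unfolding geodesic_def using e D by (auto simp: Pi_iff)
    moreover have "e ` {0..D} = (\<lambda>s. e (D - s)) ` {0..D}"
    proof -
      have "{0..D} = (\<lambda>s. D - s) ` {0..D}"
        by (auto simp: image_iff intro!: bexI[of _ "D - _"])
      then show ?thesis by (metis image_image)
    qed
    ultimately show ?thesis using D by (auto simp: geodesic_segment_def)
  qed
  define v :: "real^2" where "v = axis 1 1"
  have nv: "norm v = 1" by (simp add: v_def norm_axis_1)
  have seg: "t *\<^sub>R v \<in> closed_segment 0 (D *\<^sub>R v)"
  proof (cases "D = 0")
    case False
    then show ?thesis using t D unfolding in_segment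
      by (intro exI[of _ "t / D"]) (auto simp: field_simps)
  qed (use t in auto)
  have seg': "t *\<^sub>R v \<in> closed_segment (D *\<^sub>R v) 0"
    using seg by (simp add: closed_segment_commute)
  have "d x (c t) = t" using c(4)[of 0 t] c(2) t D by auto
  then have 1: "(c t, t *\<^sub>R v) \<in> comparison_points (c ` {0..D}) x 0 (D *\<^sub>R v)"
    using seg t nv by (auto simp: comparison_points_def)
  have "d y (e t) = D - t" using e(4)[of D t] e(3) t D by auto
  moreover have "dist (D *\<^sub>R v) (t *\<^sub>R v) = D - t"
    using t nv by (simp add: dist_norm flip: scaleR_diff_left)
  ultimately have 2: "(e t, t *\<^sub>R v) \<in> comparison_points (e ` {0..D}) y (D *\<^sub>R v) 0"
    using seg' t by (auto simp: comparison_points_def)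
  have eq: "dist 0 (D *\<^sub>R v) = d x y" "dist (D *\<^sub>R v) (D *\<^sub>R v) = d y y"
      "dist (D *\<^sub>R v) 0 = d y x"
    using nv D by (auto simp: D_def)
  have "d (c t) (e t) \<le> dist (t *\<^sub>R v) (t *\<^sub>R v)"
    using assms(1)[unfolded CAT0_def Let_def, THEN conjunct2, rule_format,
        OF assms(2,3,3) conjI[OF S1 conjI[OF S2 conjI[OF S3 conjI[OF eq(1) conjI[OF eq(2,3)]]]]]]
      1 2 by blast
  then have "d (c t) (e t) = 0" using nonneg[of "c t" "e t"] by simp
  moreover have "c t \<in> M" "e t \<in> M" using c(1) e(1) t by auto
  ultimately show ?thesis by simp
qed

lemma geodesic_comb_eq:
  assumes "CAT0" "x \<in> M" "y \<in> M" "geodesic c x y" "t \<in> {0..1}"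
  shows "geodesic_comb t x y = c (t * d x y)"
proof -
  have "t * d x y \<in> {0..d x y}"
    using assms(5) by (auto intro: mult_left_le_one_le)
  then show ?thesis
    unfolding geodesic_comb_def
    using assms(4) CAT0_geodesic_unique[OF assms(1-3) _ assms(4)]
    by (intro the_equality) blast+
qed

end

locale Hadamard_space = Metric_space +
  assumes nonempty: "M \<noteq> {}"
    and complete: "mcomplete"
    and CAT0: "CAT0"

end

theory Submission
  imports Defs
begin

text \<open>
  Fix a point \<open>p\<close>. Far away points with a small value of \<open>h\<close> force \<open>h\<close> to be very negative at
  distance 1 from \<open>p\<close>, so the sublevel sets \<open>{h \<le> h x}\<close> all meet one fixed ball around \<open>p\<close>.
  Let \<open>\<rho>\<close> be the supremum of their distances to \<open>p\<close>. Sublevel sets are closed and midpoint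
  convex, hence by the CN inequality the sets \<open>{h \<le> h x} \<inter> cball p (\<rho> + \<epsilon>)\<close> have
  arbitrarily small diameter, and completeness yields a point in all of them.
  This needs no a priori lower bound for \<open>h\<close>.
\<close>

text \<open>Put \<open>x\<close> at the origin, \<open>y\<close> at \<open>(c, 0)\<close> and
  \<open>z\<close> at \<open>(u, v)\<close>, with \<open>u\<close> given by the law of cosines. The
  triangle inequalities amount to \<bar>u\<bar> \<le> a, which makes the height \<open>v\<close>
  real.\<close>

lemma comparison_triangle_exists:
  fixes a b c :: real
  assumes "0 \<le> a" "0 \<le> b" "0 < c" "a \<le> b + c" "b \<le> a + c" "c \<le> a + b"
  obtains x y z :: "real^2" where "dist x y = c" "dist y z = b" "dist z x = a"
proof -
  define u where "u = (a\<^sup>2 + c\<^sup>2 - b\<^sup>2) / (2 * c)"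
  have u: "2 * c * u = a\<^sup>2 + c\<^sup>2 - b\<^sup>2" using assms(3) by (simp add: u_def)
  have "(a - c)\<^sup>2 \<le> b\<^sup>2"
    using assms by (simp add: abs_le_square_iff[symmetric])
  then have "2 * c * u \<le> 2 * c * a" unfolding u by (simp add: power2_eq_square algebra_simps)
  then have "u \<le> a" using assms(3) by simp
  have "b\<^sup>2 \<le> (a + c)\<^sup>2"
    using power_mono[OF assms(5,2)] .
  then have "2 * c * (-a) \<le> 2 * c * u" unfolding u by (simp add: power2_eq_square algebra_simps)
  then have "-a \<le> u" using assms(3) mult_le_cancel_left_pos[of "2 * c" "-a" u] by simp
  with \<open>u \<le> a\<close> have "u\<^sup>2 \<le> a\<^sup>2"
    by (simp add: abs_le_square_iff[symmetric])
  define v where "v = sqrt (a\<^sup>2 - u\<^sup>2)"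
  have v: "v\<^sup>2 = a\<^sup>2 - u\<^sup>2" using \<open>u\<^sup>2 \<le> a\<^sup>2\<close> by (simp add: v_def)
  have dist: "dist (vector [r, s] :: real^2) (vector [r', s']) = sqrt ((r - r')\<^sup>2 + (s - s')\<^sup>2)"
    for r s r' s' by (simp only: dist_vec_def L2_set_def sum_2 vector_2 dist_real_def power2_abs)
  have uv: "(c - u)\<^sup>2 + v\<^sup>2 = b\<^sup>2"
    using u v by (simp add: power2_eq_square algebra_simps)
  show ?thesis
  proof
    show "dist (vector [0, 0] :: real^2) (vector [c, 0]) = c"
      unfolding dist using assms(3) by simp
    show "dist (vector [c, 0] :: real^2) (vector [u, v]) = b"
      unfolding dist using assms(2) uv by simp
    show "dist (vector [u, v] :: real^2) (vector [0, 0]) = a"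
      unfolding dist using assms(1) v by simp
  qed
qed

text \<open>Apollonius' formula for the median: the parallelogram law for the vectors from
  \<open>z\<close> to \<open>x\<close> and \<open>y\<close>. It is the Euclidean equality case of
  \<open>CN_inequality\<close>.\<close>

lemma dist_midpoint_sq:
  fixes x y z :: "'a::real_inner"
  shows "(dist z (midpoint x y))\<^sup>2 = ((dist z x)\<^sup>2 + (dist z y)\<^sup>2) / 2 - (dist x y)\<^sup>2 / 4"
proof -
  define u v where "u = x - z" and "v = y - z"
  have "u + v = (x + y) - 2 *\<^sub>R z" by (simp add: u_def v_def scaleR_2)
  then have "midpoint x y - z = (1/2) *\<^sub>R (u + v)"
    by (simp add: midpoint_def scaleR_diff_right)
  moreover have "x - y = u - v" by (simp add: u_def v_def)
  ultimately have "dist z (midpoint x y) = norm ((1/2) *\<^sub>R (u + v))" "dist x y = norm (u - v)"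
      "dist z x = norm u" "dist z y = norm v"
    by (simp_all only: dist_norm norm_minus_commute[of z] u_def v_def)
  then show ?thesis
    by (simp add: power2_norm_eq_inner inner_add_left inner_add_right
        inner_diff_left inner_diff_right inner_commute field_simps)
qed

context Metric_space
begin

lemma geodesic_segmentI: "geodesic c x y \<Longrightarrow> geodesic_segment (c ` {0..d x y}) x y"
  by (auto simp: geodesic_segment_def)

lemma CAT0_geodesic_exists:
  assumes "CAT0" "x \<in> M" "y \<in> M"
  obtains c where "geodesic c x y"
  using assms unfolding CAT0_def geodesic_space_def by blast

text \<open>The Bruhat-Tits inequality. In the triangle \<open>x\<close>, \<open>y\<close>,
  \<open>p\<close> the midpoint of side \<open>x y\<close> and the vertex \<open>p\<close> are no
  farther apart than their comparison points, whose distance is the Euclidean median.\<close>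

lemma CN_inequality:
  assumes "CAT0" "p \<in> M" "x \<in> M" "y \<in> M" "geodesic c x y"
  shows "(d p (c (d x y / 2)))\<^sup>2 \<le> ((d p x)\<^sup>2 + (d p y)\<^sup>2) / 2 - (d x y)\<^sup>2 / 4"
proof (cases "x = y")
  case True
  then show ?thesis using assms by (simp add: geodesic_def)
next
  case False
  then have pos: "0 < d x y" using assms by simp
  obtain x' y' p' :: "real^2" where
    e: "dist x' y' = d x y" "dist y' p' = d y p" "dist p' x' = d p x"
  proof (rule comparison_triangle_exists[of "d p x" "d y p" "d x y"])
    show "d p x \<le> d y p + d x y" "d y p \<le> d p x + d x y" "d x y \<le> d p x + d y p"
      using triangle[of p y x] triangle[of y x p] triangle[of x p y] assms(2-4)
      by (simp_all add: commute)
  qed (use pos in auto)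
  obtain c2 where g2: "geodesic c2 y p" using CAT0_geodesic_exists[OF assms(1,4,2)] .
  obtain c3 where g3: "geodesic c3 p x" using CAT0_geodesic_exists[OF assms(1,2,3)] .
  note S = geodesic_segmentI[OF assms(5)] geodesic_segmentI[OF g2] geodesic_segmentI[OF g3]
  let ?m = "c (d x y / 2)"
  have "d x ?m = d x y / 2"
  proof -
    have "d (c 0) ?m = \<bar>0 - d x y / 2\<bar>" "c 0 = x"
      using assms(5) pos unfolding geodesic_def by auto
    then show ?thesis using pos by simp
  qed
  then have 1: "(?m, midpoint x' y') \<in> comparison_points (c ` {0..d x y}) x x' y'"
    using pos by (auto simp: comparison_points_def e dist_midpoint midpoint_in_closed_segment)
  \<comment> \<open>The vertex \<open>p\<close> enters the comparison as the starting point of the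
    third side.\<close>
  have "c3 0 = p" using g3 by (simp add: geodesic_def)
  then have 2: "(p, p') \<in> comparison_points (c3 ` {0..d p x}) p p' x'"
    using assms by (auto simp: comparison_points_def image_iff intro!: bexI[of _ 0])
  have "d p ?m \<le> dist p' (midpoint x' y')"
    using assms(1)[unfolded CAT0_def Let_def, THEN conjunct2, rule_format,
        OF assms(3,4,2) conjI[OF S(1) conjI[OF S(2) conjI[OF S(3) conjI[OF e(1) conjI[OF e(2,3)]]]]]]
      1 2 by blast
  then have "(d p ?m)\<^sup>2 \<le> (dist p' (midpoint x' y'))\<^sup>2"
    by (intro power_mono) auto
  also have "\<dots> = ((d p x)\<^sup>2 + (d p y)\<^sup>2) / 2 - (d x y)\<^sup>2 / 4"
    using e by (simp add: dist_midpoint_sq dist_commute commute)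
  finally show ?thesis .
qed

lemma closedin_sublevel:
  assumes "lower_semicontinuous_map mtopology h"
  shows "closedin mtopology {x \<in> M. h x \<le> a}"
proof -
  have "openin mtopology {x \<in> M. a < h x}"
  proof (subst openin_subopen, intro ballI)
    fix x assume x: "x \<in> {x \<in> M. a < h x}"
    then have "\<forall>\<^sub>F y in atin mtopology x. a < h y"
      using assms unfolding lower_semicontinuous_map_def by simp
    with x obtain U where U: "openin mtopology U" "x \<in> U" "\<forall>y\<in>U - {x}. a < h y"
      unfolding eventually_atin by auto
    moreover have "U \<subseteq> M" using openin_subset[OF U(1)] by simp
    ultimately show "\<exists>T. openin mtopology T \<and> x \<in> T \<and> T \<subseteq> {x \<in> M. a < h x}"
      using x by blast
  qed
  moreover have "M - {x \<in> M. h x \<le> a} = {x \<in> M. a < h x}" by auto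
  ultimately show ?thesis by (auto simp: closedin_def)
qed

lemma strongly_quasiconvex_geodesic:
  assumes "CAT0" "strongly_quasiconvex \<gamma> h" "x \<in> M" "y \<in> M" "geodesic c x y" "t \<in> {0..1}"
  shows "h (c (t * d x y)) \<le> max (h x) (h y) - t * (1 - t) * (\<gamma> / 2) * (d x y)\<^sup>2"
  using assms(2-4,6) unfolding strongly_quasiconvex_def geodesic_comb_eq[OF assms(1,3,4,5,6), symmetric]
  by blast

lemma sublevels_meet_ball:
  assumes "CAT0" "strongly_quasiconvex \<gamma> h" "p \<in> M"
  obtains R where "\<And>x. x \<in> M \<Longrightarrow> \<exists>y\<in>M. d p y \<le> R \<and> h y \<le> h x"
proof (cases "\<forall>x\<in>M. \<exists>y\<in>M. d p y \<le> 1 \<and> h y \<le> h x")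
  case True
  then show ?thesis by (intro that) auto
next
  case False
  \<comment> \<open>If \<open>R = 1\<close> fails, some \<open>w\<close> has a smaller value than
    every point of the closed unit ball about \<open>p\<close>, so \<open>h\<close> is bounded below
    there by \<open>h w\<close>.\<close>
  then obtain w where w: "\<And>y. y \<in> M \<Longrightarrow> d p y \<le> 1 \<Longrightarrow> h w < h y"
    by (meson not_le)
  have g: "\<gamma> > 0" using assms by (simp add: strongly_quasiconvex_def)
  have wp: "h w < h p" using w[of p] assms(3) by simp
  \<comment> \<open>The bound on \<open>D\<close> obtained by solving (D - 1) * \<gamma> / 2 < h p -
    h w, the inequality derived below for a far point.\<close>
  define R where "R = 1 + 2 * (h p - h w) / \<gamma>"
  have R: "1 \<le> R" using wp g by (simp add: R_def)
  show ?thesis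
  proof (rule that[of R])
    fix x assume x: "x \<in> M"
    show "\<exists>y\<in>M. d p y \<le> R \<and> h y \<le> h x"
    proof (cases "h p \<le> h x")
      case True
      then show ?thesis using assms(3) R by (intro bexI[of _ p]) auto
    next
      case hx: False
      show ?thesis
      proof (rule ccontr)
        assume "\<not> ?thesis"
        \<comment> \<open>Otherwise \<open>x\<close> itself would be a witness.\<close>
        then have Dx: "R < d p x" using x by force
        define D where "D = d p x"
        have D: "1 < D" using Dx R by (simp add: D_def)
        obtain c where c: "geodesic c p x"
          using CAT0_geodesic_exists[OF assms(1,3) x] .
        have "c 1 \<in> M" "d (c 0) (c 1) = \<bar>0 - 1\<bar>" "c 0 = p"
          using c D unfolding geodesic_def D_def by (auto simp del: abs_minus_cancel)
        then have "h w < h (c 1)" using w by simp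
        \<comment> \<open>Parameter \<open>1 / D\<close> is the point at distance 1 from
          \<open>p\<close>; the modulus term there grows linearly in \<open>D\<close>.\<close>
        also have "h (c 1) \<le> max (h p) (h x) - 1/D * (1 - 1/D) * (\<gamma> / 2) * D\<^sup>2"
          using strongly_quasiconvex_geodesic[OF assms x c, of "1 / D"] D by (simp add: D_def)
        also have "1/D * (1 - 1/D) * (\<gamma> / 2) * D\<^sup>2 = (D - 1) * (\<gamma> / 2)"
          using D by (simp add: field_simps power2_eq_square)
        finally have "(D - 1) * \<gamma> < 2 * (h p - h w)" using hx by simp
        then have "D \<le> R" using g by (simp add: R_def field_simps)
        then show False using Dx by (simp add: D_def)
      qed
    qed
  qed
qed

end

lemma (in Hadamard_space) strongly_quasiconvex_has_minimizer:
  assumes lsc: "lower_semicontinuous_map mtopology h" and qc: "strongly_quasiconvex \<gamma> h"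
  obtains z where "z \<in> M" "\<And>x. x \<in> M \<Longrightarrow> h z \<le> h x"
proof -
  obtain p where p: "p \<in> M" using nonempty by blast
  obtain R where R: "\<And>x. x \<in> M \<Longrightarrow> \<exists>y\<in>M. d p y \<le> R \<and> h y \<le> h x"
    using sublevels_meet_ball[OF CAT0 qc p] by blast
  have \<gamma>: "\<gamma> > 0" using qc by (simp add: strongly_quasiconvex_def)
  define C where "C x = {y \<in> M. h y \<le> h x}" for x
  \<comment> \<open>The distance from \<open>p\<close> to the sublevel set \<open>C x\<close>. It
    grows as \<open>h x\<close> decreases, but never beyond \<open>R\<close>, so the supremum \<rho>
    is finite.\<close>
  define D where "D x = (INF y\<in>C x. d p y)" for x
  have bdd: "bdd_below (d p ` C x)" for x by (rule bdd_belowI[of _ 0]) auto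
  have D_le: "D x \<le> d p y" if "y \<in> C x" for x y
    unfolding D_def using bdd that by (rule cINF_lower)
  have Cx: "x \<in> C x" if "x \<in> M" for x using that by (simp add: C_def)
  have D0: "0 \<le> D x" if "x \<in> M" for x
    unfolding D_def using Cx[OF that] by (intro cINF_greatest) auto
  have DR: "D x \<le> R" if x: "x \<in> M" for x
  proof -
    obtain y where "y \<in> M" "d p y \<le> R" "h y \<le> h x" using R[OF x] by blast
    then show ?thesis using D_le[of y x] by (simp add: C_def)
  qed
  have bddD: "bdd_above (D ` M)" using DR by (intro bdd_aboveI[of _ R]) auto
  define \<rho> where "\<rho> = (SUP x\<in>M. D x)"
  have D_\<rho>: "D x \<le> \<rho>" if "x \<in> M" for x
    unfolding \<rho>_def using that bddD by (rule cSUP_upper)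
  have \<rho>0: "0 \<le> \<rho>" using D_\<rho>[OF p] D0[OF p] by simp
  \<comment> \<open>The slack \<epsilon> > 0 keeps the set nonempty even if the infimum
    \<open>D x\<close> is not attained.\<close>
  define F where "F x \<epsilon> = C x \<inter> mcball p (\<rho> + \<epsilon>)" for x \<epsilon>
  define \<F> where "\<F> = {F x \<epsilon> |x \<epsilon>. x \<in> M \<and> 0 < \<epsilon>}"
  have closed: "closedin mtopology (F x \<epsilon>)" for x \<epsilon>
    unfolding F_def C_def using closedin_sublevel[OF lsc] by blast
  have F_ne: "F x \<epsilon> \<noteq> {}" if x: "x \<in> M" and \<epsilon>: "0 < \<epsilon>" for x \<epsilon>
  proof -
    have "(INF y\<in>C x. d p y) < \<rho> + \<epsilon>" using D_\<rho>[OF x] \<epsilon> by (simp add: D_def)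
    then obtain y where "y \<in> C x" "d p y < \<rho> + \<epsilon>"
      using cINF_less_iff[OF _ bdd] Cx[OF x] by blast
    then show ?thesis using p by (auto simp: F_def C_def)
  qed
  \<comment> \<open>\<open>F\<close> shrinks as \<open>h x\<close> or \<epsilon> decreases, so the
    family is directed: the point with the smaller value and the smaller radius give a member inside
    two given ones. Containing a whole member, rather than being nonempty, is what the induction can
    carry.\<close>
  have fip: "\<exists>x\<in>M. \<exists>\<epsilon>>0. F x \<epsilon> \<subseteq> \<Inter>\<G>" if "finite \<G>" "\<G> \<subseteq> \<F>" for \<G>
    using that
  proof (induction \<G>)
    case empty
    then show ?case using p by (auto intro!: bexI[of _ p] exI[of _ 1])
  next
    case (insert G \<G>)
    then obtain x \<epsilon> where x: "x \<in> M" "0 < \<epsilon>" "F x \<epsilon> \<subseteq> \<Inter>\<G>" by auto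
    obtain y \<delta> where y: "y \<in> M" "0 < \<delta>" "G = F y \<delta>" using insert by (auto simp: \<F>_def)
    define z where "z = (if h x \<le> h y then x else y)"
    have "F z (min \<epsilon> \<delta>) \<subseteq> F x \<epsilon>" "F z (min \<epsilon> \<delta>) \<subseteq> F y \<delta>"
      by (auto simp: F_def C_def z_def)
    then show ?case using x y by (intro bexI[of _ z] exI[of _ "min \<epsilon> \<delta>"]) (auto simp: z_def)
  qed
  have small: "\<exists>x\<in>M. \<exists>\<epsilon>>0. \<exists>a. F x \<epsilon> \<subseteq> mcball a e" if "0 < e" for e
  proof -
    \<comment> \<open>For \<open>u\<close>, \<open>v\<close> in F x \<delta> with D x > \<rho> -
      \<delta>, the CN inequality bounds the square of \<open>d u v\<close> by 16 * \<rho> *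
      \<delta> plus four times the square of \<delta>. Since \<delta> \<le> 1, this is at most
      \<delta> * (16 * \<rho> + 4).\<close>
    define \<delta> where "\<delta> = min 1 (e\<^sup>2 / (16 * \<rho> + 4))"
    have \<delta>: "0 < \<delta>" "\<delta> \<le> 1" "\<delta> * (16 * \<rho> + 4) \<le> e\<^sup>2"
    proof -
      have "\<delta> \<le> e\<^sup>2 / (16 * \<rho> + 4)" by (simp add: \<delta>_def)
      then show "\<delta> * (16 * \<rho> + 4) \<le> e\<^sup>2" using \<rho>0 by (simp add: field_simps)
    qed (use that \<rho>0 in \<open>auto simp: \<delta>_def\<close>)
    have "\<rho> - \<delta> < (SUP x\<in>M. D x)" using \<delta> by (simp add: \<rho>_def)
    then obtain x where x: "x \<in> M" "\<rho> - \<delta> < D x"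
      using less_cSUP_iff[OF _ bddD] p by blast
    have dist: "d u v \<le> e" if uv: "u \<in> F x \<delta>" "v \<in> F x \<delta>" for u v
    proof -
      have u: "u \<in> M" "h u \<le> h x" "d p u \<le> \<rho> + \<delta>"
        and v: "v \<in> M" "h v \<le> h x" "d p v \<le> \<rho> + \<delta>"
        using uv by (auto simp: F_def C_def)
      obtain c where c: "geodesic c u v"
        using CAT0_geodesic_exists[OF CAT0 u(1) v(1)] .
      let ?m = "c (d u v / 2)"
      have "?m \<in> M" using c by (auto simp: geodesic_def Pi_iff)
      moreover have "h ?m \<le> h x"
      proof -
        have "h ?m \<le> max (h u) (h v) - 1/2 * (1 - 1/2) * (\<gamma> / 2) * (d u v)\<^sup>2"
          using strongly_quasiconvex_geodesic[OF CAT0 qc u(1) v(1) c, of "1/2"] by simp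
        also have "\<dots> \<le> max (h u) (h v)" using \<gamma> by simp
        finally show ?thesis using u v by simp
      qed
      \<comment> \<open>The midpoint stays in the sublevel set, so it cannot be closer to
        \<open>p\<close> than \<open>D x\<close>.\<close>
      ultimately have m: "D x \<le> d p ?m" by (intro D_le) (simp add: C_def)
      have "(D x)\<^sup>2 \<le> (d p ?m)\<^sup>2" using m D0[OF x(1)] by (intro power_mono) auto
      also have "\<dots> \<le> ((d p u)\<^sup>2 + (d p v)\<^sup>2) / 2 - (d u v)\<^sup>2 / 4"
        by (rule CN_inequality[OF CAT0 p u(1) v(1) c])
      finally have "(d u v)\<^sup>2 \<le> 2 * ((d p u)\<^sup>2 + (d p v)\<^sup>2) - 4 * (D x)\<^sup>2" by linarith
      moreover have "(d p u)\<^sup>2 \<le> (\<rho> + \<delta>)\<^sup>2" "(d p v)\<^sup>2 \<le> (\<rho> + \<delta>)\<^sup>2"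
        using u v by (auto intro: power_mono)
      \<comment> \<open>Expanding the square of \<rho> - D x avoids squaring \<rho> - \<delta>,
        which may be negative.\<close>
      moreover have "\<rho>\<^sup>2 - 2 * \<rho> * \<delta> \<le> (D x)\<^sup>2"
      proof -
        have "\<rho> * (\<rho> - 2 * \<delta>) \<le> \<rho>\<^sup>2 - 2 * \<rho> * (\<rho> - D x)"
          using mult_left_mono[of "\<rho> - D x" \<delta> \<rho>] x \<rho>0
          by (simp add: power2_eq_square algebra_simps)
        also have "\<dots> \<le> (D x)\<^sup>2"
          using zero_le_power2[of "\<rho> - D x"] by (simp add: power2_eq_square algebra_simps)
        finally show ?thesis by (simp add: power2_eq_square algebra_simps)
      qed
      moreover have "\<delta>\<^sup>2 \<le> \<delta>" using \<delta> by (simp add: power2_eq_square mult_left_le)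
      ultimately have "(d u v)\<^sup>2 \<le> \<delta> * (16 * \<rho> + 4)"
        by (simp add: power2_eq_square algebra_simps)
      with \<delta> have "(d u v)\<^sup>2 \<le> e\<^sup>2" by simp
      then show ?thesis using \<open>0 < e\<close> by (meson less_imp_le power2_le_imp_le)
    qed
    obtain a where a: "a \<in> F x \<delta>" using F_ne[OF x(1) \<delta>(1)] by blast
    then have "F x \<delta> \<subseteq> mcball a e" using dist by (auto simp: F_def C_def)
    then show ?thesis using x(1) \<delta>(1) by blast
  qed
  \<comment> \<open>Cantor's intersection criterion: closed sets with the finite intersection
    property, some of them inside arbitrarily small balls.\<close>
  have "\<Inter>\<F> \<noteq> {}"
  proof (rule mcomplete_fip[THEN iffD1, OF complete, rule_format], intro conjI ballI allI impI)
    show "closedin mtopology A" if "A \<in> \<F>" for A using that closed by (auto simp: \<F>_def)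
    show "\<exists>C a. C \<in> \<F> \<and> C \<subseteq> mcball a e" if "0 < e" for e
      using small[OF that] by (auto simp: \<F>_def)
    show "\<Inter>\<G> \<noteq> {}" if "finite \<G> \<and> \<G> \<subseteq> \<F>" for \<G>
      using fip[of \<G>] F_ne that by blast
  qed
  \<comment> \<open>Membership in every \<open>C x\<close> is what makes \<open>z\<close> a
    minimizer, so one fixed radius suffices.\<close>
  then obtain z where z: "\<And>x. x \<in> M \<Longrightarrow> z \<in> F x 1" by (force simp: \<F>_def)
  show ?thesis
  proof
    show "z \<in> M" using z[OF p] by (simp add: F_def C_def)
    show "h z \<le> h x" if "x \<in> M" for x using z[OF that] by (simp add: F_def C_def)
  qed
qed

theorem corollary3p10:
  fixes X :: "'a set" and d :: "'a \<Rightarrow> 'a \<Rightarrow> real" and h :: "'a \<Rightarrow> real" and \<gamma> :: real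
  assumes "Hadamard_space X d"
    and "lower_semicontinuous_map (Metric_space.mtopology X d) h"
    and "Metric_space.strongly_quasiconvex X d \<gamma> h"
  shows "{x. is_arg_min h (\<lambda>x. x \<in> X) x} \<noteq> {}"
proof -
  obtain z where "z \<in> X" "\<And>x. x \<in> X \<Longrightarrow> h z \<le> h x"
    using Hadamard_space.strongly_quasiconvex_has_minimizer[OF assms] by blast
  then have "is_arg_min h (\<lambda>x. x \<in> X) z" by (auto simp: is_arg_min_linorder)
  then show ?thesis by blast
qed

end
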